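(* For all integers $n \geq 4$, every graph $G$ in the class $\mathsf{MH}$ with order $n$ satisfies $\chi''_{\mathcal{D}_1,\mathcal{D}_1}(G) = 4$.
   Context: All graphs are finite, simple, loopless and undirected. $\mathcal{D}_1$ denotes the class of all forests (acyclic graphs). A $(\mathcal{D}_1,\mathcal{D}_1)$-total colouring of a graph $G$ is a colouring of the vertices and edges of $G$ such that for each colour $i$, the vertices coloured $i$ induce a subgraph of $G$ that is a forest, the edges coloured $i$ induce a subgraph of $G$ that is a forest, and every edge receives a colour different from the colours of its two end vertices. (Adjacent vertices may share a colour, and so may adjacent edges.) $\chi''_{\mathcal{D}_1,\mathcal{D}_1}(G)$ is the minimum number of colours in such a colouring of $G$. The class $\mathsf{MH}$: for each integer $n\ge 4$ it contains the graph on vertices $v_1,\dots,v_n$ whose edges are: the edges of the cycle $v_1v_2\cdots v_nv_1$; all edges $v_iv_j$ with $i\neq j$, $2\le i,j\le n$ and $i+j=n+2$; all edges $v_iv_j$ with $i\ne j$, $2\le i,j\le n$ and $i+j=n+1$; and all edges $v_1v_i$ with $3\le i\le n-1$. (An edge listed more than once is taken once.) $\mathsf{MH}$ is the class of all graphs so obtained. *)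

theory Defs
  imports Main
begin

type_synonym 'a ugraph = "'a set \<times> 'a set set"

abbreviation verts :: "'a ugraph \<Rightarrow> 'a set" where
  "verts G \<equiv> fst G"

abbreviation edges :: "'a ugraph \<Rightarrow> 'a set set" where
  "edges G \<equiv> snd G"

definition simple_graph :: "'a ugraph \<Rightarrow> bool" where
  "simple_graph G \<longleftrightarrow>
     finite (verts G) \<and> (\<forall>e\<in>edges G. e \<subseteq> verts G \<and> card e = 2)"

text \<open>A cycle is given by the list of its vertices; the closing edge joins the last
  vertex to the first.\<close>

definition is_cycle :: "'a ugraph \<Rightarrow> 'a list \<Rightarrow> bool" where
  "is_cycle G xs \<longleftrightarrow>
     length xs \<ge> 3 \<and> distinct xs \<and> set xs \<subseteq> verts G \<and>
     (\<forall>i<length xs. {xs ! i, xs ! (Suc i mod length xs)} \<in> edges G)"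

text \<open>The graph without vertices counts as a forest, so that a colour may be used on
  vertices only, on edges only, or not at all.\<close>

definition D1 :: "'a ugraph set" where
  "D1 = {G. simple_graph G \<and> (\<nexists>xs. is_cycle G xs)}"

definition vertex_induced :: "'a ugraph \<Rightarrow> 'a set \<Rightarrow> 'a ugraph" where
  "vertex_induced G U = (U, {e \<in> edges G. e \<subseteq> U})"

definition edge_induced :: "'a set set \<Rightarrow> 'a ugraph" where
  "edge_induced F = (\<Union>F, F)"

definition D1_D1_total_colouring ::
    "'a ugraph \<Rightarrow> nat \<Rightarrow> ('a \<Rightarrow> nat) \<Rightarrow> ('a set \<Rightarrow> nat) \<Rightarrow> bool" where
  "D1_D1_total_colouring G k f g \<longleftrightarrow>
     (\<forall>x\<in>verts G. f x < k) \<and> (\<forall>e\<in>edges G. g e < k) \<and>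
     (\<forall>i<k. vertex_induced G {x \<in> verts G. f x = i} \<in> D1) \<and>
     (\<forall>i<k. edge_induced {e \<in> edges G. g e = i} \<in> D1) \<and>
     (\<forall>e\<in>edges G. \<forall>x\<in>e. g e \<noteq> f x)"

text \<open>For a simple graph the minimum is attained: giving all vertices and edges pairwise
  different colours is such a colouring.\<close>

definition chi_D1_D1 :: "'a ugraph \<Rightarrow> nat" where
  "chi_D1_D1 G = (LEAST k. \<exists>f g. D1_D1_total_colouring G k f g)"

definition MH_graph :: "(nat \<Rightarrow> 'a) \<Rightarrow> nat \<Rightarrow> 'a ugraph" where
  "MH_graph v n =
     (v ` {1..n},
      {{v i, v (i + 1)} | i. 1 \<le> i \<and> i < n} \<union> {{v n, v 1}} \<union>
      {{v i, v j} | i j. i \<noteq> j \<and> i \<in> {2..n} \<and> j \<in> {2..n} \<and> i + j = n + 2} \<union>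
      {{v i, v j} | i j. i \<noteq> j \<and> i \<in> {2..n} \<and> j \<in> {2..n} \<and> i + j = n + 1} \<union>
      {{v 1, v i} | i. 3 \<le> i \<and> i \<le> n - 1})"

text \<open>The names of the vertices are arbitrary, so the class is closed under isomorphism.\<close>

definition MH :: "'a ugraph set" where
  "MH = {MH_graph v n | v n. n \<ge> 4 \<and> inj_on v {1..n}}"

end

theory Submission
  imports Defs
begin

text \<open>
  The spokes and the two families of chords hide a simple structure. List the vertices as
  \<open>v\<^sub>1, v\<^sub>n, v\<^sub>2, v\<^bsub>n-1\<^esub>, v\<^sub>3, \<dots>\<close> and number them \<open>0, 1, 2, \<dots>\<close>. The chords with
  index sum \<open>n + 2\<close> or \<open>n + 1\<close> then join vertices at distance one in this list, the cycle edges
  avoiding \<open>v\<^sub>1\<close> join vertices at distance at most two, and \<open>v\<^sub>1\<close>, at position \<open>0\<close>, is joined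
  to everything. So the graph is a hub joined to the square of a path
  (lemma \<open>MH_graph_edge_cases\<close>).

  Four colours suffice because the vertex at position \<open>b\<close> has at most three earlier neighbours,
  at positions \<open>0\<close>, \<open>b - 1\<close> and \<open>b - 2\<close>. Colour the hub \<open>0\<close> and the other positions
  cyclically with three further colours; this is a proper vertex colouring. If the edges from \<open>b\<close>
  to its earlier neighbours receive different colours, then every colour class of edges grows by
  at most one pendant edge at each step and is a forest (lemma \<open>D1_if_unique_earlier_neighbour\<close>).
  Three colours other than that of \<open>b\<close> are available, and they can be distributed so that no edge
  has the colour of its earlier end (lemma \<open>hub_and_path_square_colouring\<close>).

  Three colours do not suffice because \<open>v\<^sub>1, v\<^sub>2, v\<^bsub>n-1\<^esub>, v\<^sub>n\<close> span a complete graph on four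
  vertices, in which three colours already force a monochromatic cycle (lemma \<open>K4_needs_four_colours\<close>).
\<close>

section \<open>Forests and monochromatic cycles\<close>

text \<open>The last vertex of a cycle in the given order has both its neighbours on the cycle before
  it, and these are two different vertices.\<close>

lemma D1_if_unique_earlier_neighbour:
  fixes \<rho> :: "'a \<Rightarrow> nat"
  assumes simple: "simple_graph G"
    and inj: "inj_on \<rho> (verts G)"
    and unique: "\<And>x y z. {x, z} \<in> edges G \<Longrightarrow> {y, z} \<in> edges G \<Longrightarrow>
                   \<rho> x < \<rho> z \<Longrightarrow> \<rho> y < \<rho> z \<Longrightarrow> x = y"
  shows "G \<in> D1"
proof -
  have False if cyc: "is_cycle G xs" for xs
  proof -
    let ?n = "length xs"
    have n: "?n \<ge> 3" and dist: "distinct xs" and sub: "set xs \<subseteq> verts G"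
      and adj: "\<And>i. i < ?n \<Longrightarrow> {xs ! i, xs ! (Suc i mod ?n)} \<in> edges G"
      using cyc by (auto simp: is_cycle_def)
    have "set xs \<noteq> {}" using n by auto
    then have "Max (\<rho> ` set xs) \<in> \<rho> ` set xs" by (intro Max_in) auto
    then obtain i where i: "i < ?n" "\<rho> (xs ! i) = Max (\<rho> ` set xs)"
      by (auto simp: in_set_conv_nth)
    have lower: "\<rho> (xs ! j) < \<rho> (xs ! i)" if "j < ?n" "j \<noteq> i" for j
    proof -
      have "\<rho> (xs ! j) \<le> \<rho> (xs ! i)" using that i by simp
      moreover have "xs ! j \<noteq> xs ! i" using that i dist by (simp add: nth_eq_iff_index_eq)
      then have "\<rho> (xs ! j) \<noteq> \<rho> (xs ! i)"
        using that i sub inj by (meson inj_on_def nth_mem subsetD)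
      ultimately show ?thesis by simp
    qed
    define s where "s = (if Suc i = ?n then 0 else Suc i)"
    define p where "p = (if i = 0 then ?n - 1 else i - 1)"
    have s: "s < ?n" "s \<noteq> i" "Suc i mod ?n = s"
      and p: "p < ?n" "p \<noteq> i" "Suc p mod ?n = i" and "s \<noteq> p"
      using i n by (auto simp: s_def p_def)
    have "{xs ! s, xs ! i} \<in> edges G" using adj[of i] i s by (simp add: insert_commute)
    moreover have "{xs ! p, xs ! i} \<in> edges G" using adj[of p] p by simp
    ultimately have "xs ! s = xs ! p" using unique lower s p by blast
    then show False using \<open>s \<noteq> p\<close> dist s p by (simp add: nth_eq_iff_index_eq)
  qed
  then show ?thesis using simple by (auto simp: D1_def)
qed

lemma is_cycle_triangle:
  assumes "distinct [a, b, c]" "{a, b, c} \<subseteq> verts G"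
    and "{a, b} \<in> edges G" "{b, c} \<in> edges G" "{c, a} \<in> edges G"
  shows "is_cycle G [a, b, c]"
  using assms by (auto simp: is_cycle_def less_Suc_eq)

lemma is_cycle_quadrilateral:
  assumes "distinct [a, b, c, d]" "{a, b, c, d} \<subseteq> verts G"
    and "{a, b} \<in> edges G" "{b, c} \<in> edges G" "{c, d} \<in> edges G" "{d, a} \<in> edges G"
  shows "is_cycle G [a, b, c, d]"
  using assms by (auto simp: is_cycle_def less_Suc_eq)

lemma no_monochromatic_vertex_triangle:
  assumes col: "D1_D1_total_colouring G k f g"
    and "distinct [a, b, c]" "{a, b, c} \<subseteq> verts G"
    and "{a, b} \<in> edges G" "{b, c} \<in> edges G" "{c, a} \<in> edges G"
  shows "\<not> (f a = f b \<and> f b = f c)"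
proof
  assume eq: "f a = f b \<and> f b = f c"
  let ?H = "vertex_induced G {x \<in> verts G. f x = f a}"
  have "is_cycle ?H [a, b, c]"
    by (rule is_cycle_triangle) (use assms eq in \<open>auto simp: vertex_induced_def\<close>)
  moreover have "?H \<in> D1" using assms by (auto simp: D1_D1_total_colouring_def)
  ultimately show False by (auto simp: D1_def)
qed

lemma no_monochromatic_edge_cycle:
  assumes col: "D1_D1_total_colouring G k f g" and "e \<in> edges G"
  shows "\<not> is_cycle (edge_induced {d \<in> edges G. g d = g e}) xs"
  using assms by (auto simp: D1_D1_total_colouring_def D1_def)

lemma no_monochromatic_edge_triangle:
  assumes col: "D1_D1_total_colouring G k f g"
    and "distinct [a, b, c]"
    and "{a, b} \<in> edges G" "{b, c} \<in> edges G" "{c, a} \<in> edges G"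
  shows "\<not> (g {a, b} = g {b, c} \<and> g {b, c} = g {c, a})"
proof
  assume eq: "g {a, b} = g {b, c} \<and> g {b, c} = g {c, a}"
  have "is_cycle (edge_induced {d \<in> edges G. g d = g {a, b}}) [a, b, c]"
    by (rule is_cycle_triangle) (use assms eq in \<open>auto simp: edge_induced_def\<close>)
  with no_monochromatic_edge_cycle[OF col] assms show False by blast
qed

lemma no_monochromatic_edge_quadrilateral:
  assumes col: "D1_D1_total_colouring G k f g"
    and "distinct [a, b, c, d]"
    and "{a, b} \<in> edges G" "{b, c} \<in> edges G" "{c, d} \<in> edges G" "{d, a} \<in> edges G"
  shows "\<not> (g {a, b} = g {b, c} \<and> g {b, c} = g {c, d} \<and> g {c, d} = g {d, a})"
proof
  assume eq: "g {a, b} = g {b, c} \<and> g {b, c} = g {c, d} \<and> g {c, d} = g {d, a}"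
  have "is_cycle (edge_induced {h \<in> edges G. g h = g {a, b}}) [a, b, c, d]"
    by (rule is_cycle_quadrilateral) (use assms eq in \<open>auto simp: edge_induced_def\<close>)
  with no_monochromatic_edge_cycle[OF col] assms show False by blast
qed

section \<open>Four mutually adjacent vertices need four colours\<close>

definition is_clique :: "'a ugraph \<Rightarrow> 'a set \<Rightarrow> bool" where
  "is_clique G K \<longleftrightarrow> K \<subseteq> verts G \<and> (\<forall>x\<in>K. \<forall>y\<in>K. x \<noteq> y \<longrightarrow> {x, y} \<in> edges G)"

text \<open>With only three colours, an edge whose ends have different colours must have the third
  colour. So if \<open>a\<close> and \<open>b\<close> share a colour, the edges from \<open>c\<close> to \<open>a\<close> and \<open>b\<close> agree, and likewise
  those from \<open>d\<close>. If \<open>c\<close> and \<open>d\<close> have the same colour, these four edges form a monochromatic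
  quadrilateral. Otherwise the edge \<open>ab\<close> has the colour of \<open>c\<close> or of \<open>d\<close>, which is the common
  colour of the two edges at the other of them, and closes a monochromatic triangle.\<close>

lemma K4_with_repeated_colour_needs_four_colours:
  assumes col: "D1_D1_total_colouring G k f g"
    and clique: "is_clique G {a, b, c, d}" and dist: "distinct [a, b, c, d]"
    and "f a = f b"
  shows "k \<ge> 4"
proof (rule ccontr)
  assume "\<not> k \<ge> 4"
  then have k: "k \<le> 3" by simp
  have V: "{a, b, c, d} \<subseteq> verts G" using clique by (simp add: is_clique_def)
  have E: "{x, y} \<in> edges G" if "x \<in> {a, b, c, d}" "y \<in> {a, b, c, d}" "x \<noteq> y" for x y
    using that clique unfolding is_clique_def by blast
  have f: "f x < 3" if "x \<in> {a, b, c, d}" for x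
  proof -
    have "x \<in> verts G" using that V by blast
    then have "f x < k" using col by (simp add: D1_D1_total_colouring_def)
    then show ?thesis using k by simp
  qed
  have g: "g {x, y} < 3 \<and> g {x, y} \<noteq> f x \<and> g {x, y} \<noteq> f y"
    if "x \<in> {a, b, c, d}" "y \<in> {a, b, c, d}" "x \<noteq> y" for x y
  proof -
    have "g {x, y} < k \<and> g {x, y} \<noteq> f x \<and> g {x, y} \<noteq> f y"
      using col E[OF that] by (simp add: D1_D1_total_colouring_def)
    then show ?thesis using k by simp
  qed
  have ab: "{a, b} \<in> edges G" and bc: "{b, c} \<in> edges G" and ca: "{c, a} \<in> edges G"
    and bd: "{b, d} \<in> edges G" and da: "{d, a} \<in> edges G" and ad: "{a, d} \<in> edges G"
    and db: "{d, b} \<in> edges G"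
    by (rule E; use dist in auto)+
  have fc: "f c \<noteq> f a" and fd: "f d \<noteq> f a"
    using no_monochromatic_vertex_triangle[OF col, of a b c, OF _ _ ab bc ca]
      no_monochromatic_vertex_triangle[OF col, of a b d, OF _ _ ab bd da] dist V \<open>f a = f b\<close>
    by auto
  have forced: "g {x, y} = r"
    if "x \<in> {a, b, c, d}" "y \<in> {a, b, c, d}" "f x \<noteq> f y" "r < 3" "r \<noteq> f x" "r \<noteq> f y"
    for x y r
  proof -
    have "x \<noteq> y" using that by auto
    with that have "f x < 3" "f y < 3" "g {x, y} < 3" "g {x, y} \<noteq> f x" "g {x, y} \<noteq> f y"
      using f g by blast+
    with that(3-) show ?thesis by linarith
  qed
  have r: "g {c, a} < 3" "g {c, a} \<noteq> f c" "g {c, a} \<noteq> f a"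
    "g {a, d} < 3" "g {a, d} \<noteq> f d" "g {a, d} \<noteq> f a"
    using g[of c a] g[of a d] dist by auto
  have gbc: "g {b, c} = g {c, a}"
    by (rule forced) (use r(1-3) fc \<open>f a = f b\<close> in auto)
  have gdb: "g {d, b} = g {a, d}"
    by (rule forced) (use r(4-6) fd \<open>f a = f b\<close> in auto)
  show False
  proof (cases "f c = f d")
    case True
    have "g {a, d} = g {c, a}"
      by (rule forced) (use r(1-3) fd True in auto)
    then show False
      using no_monochromatic_edge_quadrilateral[OF col, of a d b c, OF _ ad db bc ca] gbc gdb dist
      by auto
  next
    case False
    have gca: "g {c, a} = f d" by (rule forced) (use False fc fd f in auto)
    have gad: "g {a, d} = f c" by (rule forced) (use False fc fd f in auto)
    have "g {a, b} < 3" "g {a, b} \<noteq> f a" "f a < 3" "f c < 3" "f d < 3"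
      using g[of a b] f dist by auto
    then have "g {a, b} = f c \<or> g {a, b} = f d" using False fc fd by linarith
    moreover have "g {a, b} \<noteq> f d"
      using no_monochromatic_edge_triangle[OF col, of a b c, OF _ ab bc ca] gbc gca dist by auto
    moreover have "g {a, b} \<noteq> f c"
      using no_monochromatic_edge_triangle[OF col, of a b d, OF _ ab bd da] gdb gad dist
      by (auto simp: insert_commute)
    ultimately show False by blast
  qed
qed

lemma K4_needs_four_colours:
  assumes col: "D1_D1_total_colouring G k f g"
    and clique: "is_clique G K" and "card K = 4"
  shows "k \<ge> 4"
proof (rule ccontr)
  assume "\<not> k \<ge> 4"
  moreover have "f ` K \<subseteq> {..<k}"
    using col clique by (auto simp: D1_D1_total_colouring_def is_clique_def)
  ultimately have "card (f ` K) < card K"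
    using \<open>card K = 4\<close> by (metis card_lessThan card_mono finite_lessThan le_less_trans not_le)
  then obtain a b where ab: "a \<in> K" "b \<in> K" "a \<noteq> b" "f a = f b"
    using pigeonhole inj_onI by metis
  have "card (K - {a, b}) = 2"
    using ab \<open>card K = 4\<close> by (simp add: card_Diff_subset)
  then obtain c d where "K - {a, b} = {c, d}" "c \<noteq> d" by (auto simp: card_2_iff)
  then have "K = {a, b, c, d}" "distinct [a, b, c, d]" using ab by auto
  then show False
    using K4_with_repeated_colour_needs_four_colours[OF col _ _ \<open>f a = f b\<close>] clique
      \<open>\<not> k \<ge> 4\<close> by blast
qed

section \<open>Four colours suffice for a hub joined to the square of a path\<close>

definition position_colour :: "nat \<Rightarrow> nat" where
  "position_colour b = (if b = 0 then 0 else Suc (b mod 3))"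

text \<open>For an edge between the positions \<open>a < b\<close>. Positions \<open>b + 1\<close> and \<open>b + 2\<close> have the two cyclic
  colours that \<open>b\<close> does not have. The edge to \<open>b - 2\<close> cannot take the colour of \<open>b + 1\<close>, as \<open>b - 2\<close>
  has it too, so the hub edge does.\<close>

definition link_colour :: "nat \<Rightarrow> nat \<Rightarrow> nat" where
  "link_colour a b =
     (if a = 0 then position_colour (b + 1)
      else if b = a + 1 then 0 else position_colour (b + 2))"

lemma position_colour_less: "position_colour b < 4"
  by (simp add: position_colour_def)

lemma link_colour_less: "link_colour a b < 4"
  by (simp add: link_colour_def position_colour_less)

lemma position_colour_proper:
  assumes "a < b" "a = 0 \<or> b \<le> a + 2"
  shows "position_colour a \<noteq> position_colour b"
proof -
  consider "a = 0" | "a \<noteq> 0" "b = a + 1" | "a \<noteq> 0" "b = a + 2" using assms by linarith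
  then show ?thesis
    using assms by cases (auto simp: position_colour_def, presburger+)
qed

lemma link_colour_avoids_ends:
  assumes "a < b" "a = 0 \<or> b \<le> a + 2"
  shows "link_colour a b \<noteq> position_colour a" "link_colour a b \<noteq> position_colour b"
proof -
  consider "a = 0" | "a \<noteq> 0" "b = a + 1" | "a \<noteq> 0" "b = a + 2" using assms by linarith
  then have "link_colour a b \<noteq> position_colour a \<and> link_colour a b \<noteq> position_colour b"
    using assms by cases (auto simp: position_colour_def link_colour_def, presburger+)
  then show "link_colour a b \<noteq> position_colour a" "link_colour a b \<noteq> position_colour b" by auto
qed

lemma link_colour_inject:
  assumes "a < b" "a = 0 \<or> b \<le> a + 2" "a' < b" "a' = 0 \<or> b \<le> a' + 2"
    and "link_colour a b = link_colour a' b"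
  shows "a = a'"
proof -
  have "Suc b mod 3 \<noteq> Suc (Suc b) mod 3" by presburger
  then show ?thesis
    using assms by (auto simp: position_colour_def link_colour_def split: if_splits)
qed

text \<open>Only an upper bound on the edges is assumed: an edge avoiding the hub spans at most two
  positions. At each position the links to earlier positions have pairwise different colours
  (lemma \<open>link_colour_inject\<close>), so an edge colour gives a vertex at most one earlier neighbour.\<close>

lemma hub_and_path_square_colouring:
  fixes \<rho> :: "'a \<Rightarrow> nat"
  assumes simple: "simple_graph G"
    and inj: "inj_on \<rho> (verts G)"
    and close: "\<And>x y. {x, y} \<in> edges G \<Longrightarrow> \<rho> x < \<rho> y \<Longrightarrow> \<rho> x = 0 \<or> \<rho> y \<le> \<rho> x + 2"
  shows "\<exists>f g. D1_D1_total_colouring G 4 f g"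
proof -
  define f where "f x = position_colour (\<rho> x)" for x
  define g where "g e = link_colour (Min (\<rho> ` e)) (Max (\<rho> ` e))" for e
  have g: "g {x, y} = link_colour (\<rho> x) (\<rho> y)" if "\<rho> x < \<rho> y" for x y
    using that by (simp add: g_def)
  have edge: "\<exists>x y. e = {x, y} \<and> \<rho> x < \<rho> y \<and> (\<rho> x = 0 \<or> \<rho> y \<le> \<rho> x + 2)"
    if "e \<in> edges G" for e
  proof -
    have "card e = 2" using that simple by (simp add: simple_graph_def)
    then obtain x y where xy: "e = {x, y}" "x \<noteq> y" by (auto simp: card_2_iff)
    have "e \<subseteq> verts G" using that simple by (simp add: simple_graph_def)
    then have "x \<in> verts G" "y \<in> verts G" using xy by auto
    with xy(2) have "\<rho> x < \<rho> y \<or> \<rho> y < \<rho> x"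
      using inj by (metis inj_on_eq_iff linorder_neqE_nat)
    then show ?thesis
    proof
      assume "\<rho> x < \<rho> y"
      then show ?thesis using that xy close[of x y] by blast
    next
      assume "\<rho> y < \<rho> x"
      moreover have "e = {y, x}" using xy by blast
      ultimately show ?thesis using that close[of y x] by blast
    qed
  qed
  have vforest: "vertex_induced G {x \<in> verts G. f x = i} \<in> D1" for i
  proof (rule D1_if_unique_earlier_neighbour[where \<rho> = \<rho>])
    show "simple_graph (vertex_induced G {x \<in> verts G. f x = i})"
      using simple by (auto simp: simple_graph_def vertex_induced_def)
    show "inj_on \<rho> (verts (vertex_induced G {x \<in> verts G. f x = i}))"
      using inj by (rule inj_on_subset) (auto simp: vertex_induced_def)
    \<comment> \<open>A properly coloured graph has no edge inside a colour class.\<close>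
    show "x = y" if "{x, z} \<in> edges (vertex_induced G {x \<in> verts G. f x = i})" "\<rho> x < \<rho> z"
      for x y z
      using that close[of x z] position_colour_proper[of "\<rho> x" "\<rho> z"]
      by (auto simp: vertex_induced_def f_def)
  qed
  have eforest: "edge_induced {e \<in> edges G. g e = i} \<in> D1" for i
  proof (rule D1_if_unique_earlier_neighbour[where \<rho> = \<rho>])
    have sub: "\<Union>{e \<in> edges G. g e = i} \<subseteq> verts G"
      using simple by (auto simp: simple_graph_def)
    then show "simple_graph (edge_induced {e \<in> edges G. g e = i})"
      using simple finite_subset[OF sub] by (auto simp: simple_graph_def edge_induced_def)
    show "inj_on \<rho> (verts (edge_induced {e \<in> edges G. g e = i}))"
      using inj_on_subset[OF inj sub] by (simp add: edge_induced_def)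
    show "x = y" if "{x, z} \<in> edges (edge_induced {e \<in> edges G. g e = i})"
      "{y, z} \<in> edges (edge_induced {e \<in> edges G. g e = i})" "\<rho> x < \<rho> z" "\<rho> y < \<rho> z" for x y z
    proof -
      have E: "{x, z} \<in> edges G" "{y, z} \<in> edges G" "g {x, z} = g {y, z}"
        using that by (auto simp: edge_induced_def)
      then have "\<rho> x = \<rho> y"
        using that close[of x z] close[of y z] link_colour_inject[of "\<rho> x" "\<rho> z" "\<rho> y"]
        by (simp add: g)
      moreover have "x \<in> verts G" "y \<in> verts G"
        using E simple by (auto simp: simple_graph_def)
      ultimately show ?thesis using inj by (simp add: inj_on_eq_iff)
    qed
  qed
  have "g e \<noteq> f x" if "e \<in> edges G" "x \<in> e" for e x
    using edge[OF that(1)] that(2) link_colour_avoids_ends by (auto simp: g f_def)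
  moreover have "f x < 4" "g e < 4" for x e
    by (simp_all add: f_def g_def position_colour_less link_colour_less)
  ultimately have "D1_D1_total_colouring G 4 f g"
    using vforest eforest by (auto simp: D1_D1_total_colouring_def)
  then show ?thesis by blast
qed

section \<open>The graphs of the class\<close>

lemma MH_graph_edge_indices:
  assumes "n \<ge> 4" "e \<in> edges (MH_graph v n)"
  obtains i j where "e = {v i, v j}" "i \<in> {1..n}" "j \<in> {1..n}" "i \<noteq> j"
    "i = 1 \<or> j = i + 1 \<or> i + j = n + 2 \<or> i + j = n + 1 \<and> j \<ge> 2"
proof -
  consider (path) i where "e = {v i, v (i + 1)}" "1 \<le> i" "i < n"
    | (closing) "e = {v n, v 1}"
    | (even) i j where "e = {v i, v j}" "i \<noteq> j" "i \<in> {2..n}" "j \<in> {2..n}" "i + j = n + 2"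
    | (odd) i j where "e = {v i, v j}" "i \<noteq> j" "i \<in> {2..n}" "j \<in> {2..n}" "i + j = n + 1"
    | (spoke) i where "e = {v 1, v i}" "3 \<le> i" "i \<le> n - 1"
    using assms(2) unfolding MH_graph_def snd_conv by blast
  then show ?thesis
  proof cases
    case path
    then show ?thesis using that[of i "i + 1"] by simp
  next
    case closing
    then show ?thesis using that[of 1 n] assms(1) by (simp add: insert_commute)
  next
    case even
    then show ?thesis using that[of i j] by simp
  next
    case odd
    then show ?thesis using that[of i j] by simp
  next
    case spoke
    then show ?thesis using that[of 1 i] by simp
  qed
qed

lemma MH_graph_simple:
  assumes "n \<ge> 4" "inj_on v {1..n}"
  shows "simple_graph (MH_graph v n)"
proof -
  have "e \<subseteq> verts (MH_graph v n) \<and> card e = 2" if "e \<in> edges (MH_graph v n)" for e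
  proof -
    obtain i j where ij: "e = {v i, v j}" "i \<in> {1..n}" "j \<in> {1..n}" "i \<noteq> j"
      using MH_graph_edge_indices[OF assms(1) \<open>e \<in> edges (MH_graph v n)\<close>] .
    then have "v i \<noteq> v j" using assms(2) by (simp add: inj_on_eq_iff)
    with ij show ?thesis by (simp add: MH_graph_def)
  qed
  moreover have "finite (verts (MH_graph v n))" by (simp add: MH_graph_def)
  ultimately show ?thesis by (simp add: simple_graph_def)
qed

text \<open>The position of the \<open>i\<close>-th vertex in the list \<open>v\<^sub>1, v\<^sub>n, v\<^sub>2, v\<^bsub>n-1\<^esub>, v\<^sub>3, \<dots>\<close>: the first half
  of the cycle takes the even positions in order, the second half the odd ones in reverse.\<close>

definition zigzag :: "nat \<Rightarrow> nat \<Rightarrow> nat" where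
  "zigzag n i = (if 2 * i \<le> n + 1 then 2 * (i - 1) else 2 * (n - i) + 1)"

lemma zigzag_inj: "inj_on (zigzag n) {1..n}"
proof (rule inj_onI)
  fix i j assume "i \<in> {1..n}" "j \<in> {1..n}" "zigzag n i = zigzag n j"
  then show "i = j" unfolding zigzag_def by (auto split: if_splits) presburger+
qed

lemma MH_graph_edge_cases:
  assumes "n \<ge> 4" "e \<in> edges (MH_graph v n)"
  obtains i j where "e = {v i, v j}" "i \<in> {1..n}" "j \<in> {1..n}"
    "zigzag n i = 0 \<or> zigzag n j \<le> zigzag n i + 2 \<and> zigzag n i \<le> zigzag n j + 2"
proof -
  obtain i j where ij: "e = {v i, v j}" "i \<in> {1..n}" "j \<in> {1..n}" "i \<noteq> j"
      "i = 1 \<or> j = i + 1 \<or> i + j = n + 2 \<or> i + j = n + 1 \<and> j \<ge> 2"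
    using MH_graph_edge_indices[OF assms] .
  then have "zigzag n i = 0 \<or> zigzag n j \<le> zigzag n i + 2 \<and> zigzag n i \<le> zigzag n j + 2"
    using assms(1) unfolding zigzag_def by auto
  with ij show ?thesis by (intro that)
qed

lemma MH_graph_colouring:
  assumes "n \<ge> 4" "inj_on v {1..n}"
  shows "\<exists>f g. D1_D1_total_colouring (MH_graph v n) 4 f g"
proof -
  define \<rho> where "\<rho> = zigzag n \<circ> the_inv_into {1..n} v"
  have \<rho>: "\<rho> (v i) = zigzag n i" if "i \<in> {1..n}" for i
    using that assms(2) by (simp add: \<rho>_def the_inv_into_f_f)
  show ?thesis
  proof (rule hub_and_path_square_colouring[where \<rho> = \<rho>])
    show "simple_graph (MH_graph v n)" using assms by (rule MH_graph_simple)
    have "inj_on \<rho> (v ` {1..n})"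
      unfolding \<rho>_def
      by (rule comp_inj_on) (use assms(2) zigzag_inj in
        \<open>simp_all add: inj_on_the_inv_into the_inv_into_onto\<close>)
    then show "inj_on \<rho> (verts (MH_graph v n))" by (simp add: MH_graph_def)
    show "\<rho> x = 0 \<or> \<rho> y \<le> \<rho> x + 2"
      if edge: "{x, y} \<in> edges (MH_graph v n)" and less: "\<rho> x < \<rho> y" for x y
      using assms(1) edge
    proof (rule MH_graph_edge_cases)
      fix i j
      assume ij: "{x, y} = {v i, v j}" "i \<in> {1..n}" "j \<in> {1..n}"
        "zigzag n i = 0 \<or> zigzag n j \<le> zigzag n i + 2 \<and> zigzag n i \<le> zigzag n j + 2"
      then consider "x = v i" "y = v j" | "x = v j" "y = v i" by (auto simp: doubleton_eq_iff)
      then show ?thesis using ij less \<rho> by cases auto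
    qed
  qed
qed

lemma MH_graph_clique:
  assumes "n \<ge> 4"
  shows "is_clique (MH_graph v n) (v ` {1, 2, n - 1, n})"
proof -
  let ?E = "edges (MH_graph v n)"
  have cycle: "{v i, v (i + 1)} \<in> ?E" if "1 \<le> i" "i < n" for i
    using that by (auto simp: MH_graph_def)
  have "{v 1, v 2} \<in> ?E" "{v (n - 1), v n} \<in> ?E"
    using cycle[of 1] cycle[of "n - 1"] assms by (auto simp: numeral_2_eq_2)
  moreover have "{v n, v 1} \<in> ?E" by (simp add: MH_graph_def)
  moreover have "{v 1, v (n - 1)} \<in> ?E"
    using assms by (auto simp: MH_graph_def)
  moreover have "{v 2, v n} \<in> ?E"
  proof -
    have "{v 2, v n} \<in> {{v i, v j} | i j. i \<noteq> j \<and> i \<in> {2..n} \<and> j \<in> {2..n} \<and> i + j = n + 2}"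
      using assms by (intro CollectI exI[of _ 2] exI[of _ n]) auto
    then show ?thesis by (simp add: MH_graph_def)
  qed
  moreover have "{v 2, v (n - 1)} \<in> ?E"
  proof -
    have "{v 2, v (n - 1)} \<in>
        {{v i, v j} | i j. i \<noteq> j \<and> i \<in> {2..n} \<and> j \<in> {2..n} \<and> i + j = n + 1}"
      using assms by (intro CollectI exI[of _ 2] exI[of _ "n - 1"]) auto
    then show ?thesis by (simp add: MH_graph_def)
  qed
  moreover have "v ` {1, 2, n - 1, n} \<subseteq> verts (MH_graph v n)"
    using assms by (auto simp: MH_graph_def)
  ultimately show ?thesis unfolding is_clique_def by (auto simp: insert_commute)
qed

theorem theorem3p4:
  fixes n :: nat and G :: "'a ugraph"
  assumes "n \<ge> 4" and "G \<in> MH" and "card (verts G) = n"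
  shows "chi_D1_D1 G = 4"
proof -
  obtain v m where G: "G = MH_graph v m" and m: "m \<ge> 4" and inj: "inj_on v {1..m}"
    using assms(2) by (auto simp: MH_def)
  have "card (v ` {1, 2, m - 1, m}) = card {1, 2, m - 1, m}"
    using m by (intro card_image inj_on_subset[OF inj]) auto
  also have "\<dots> = 4" using m by auto
  finally have "card (v ` {1, 2, m - 1, m}) = 4" .
  then have "k \<ge> 4" if "\<exists>f g. D1_D1_total_colouring G k f g" for k
    using that K4_needs_four_colours MH_graph_clique[OF m] G by blast
  then show ?thesis
    unfolding chi_D1_D1_def using MH_graph_colouring[OF m inj] G by (intro Least_equality) auto
qed

end
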